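(* Let $G$ be a finite non-abelian group. Then the number of element centralizers of $G$ equals $\left|\frac{G}{Z(G)}\right|$ if and only if the number of $z$-classes of $G$ equals $\left|\frac{G}{Z(G)}\right|$. That is, $|\operatorname{Cent}(G)| = \left|\frac{G}{Z(G)}\right|$ iff $|z\text{-class}| = \left|\frac{G}{Z(G)}\right|$.
   Context: For a group $G$, $Z(G)$ is its center, $C(x)$ is the centralizer in $G$ of $x\in G$, and $\operatorname{Cent}(G)=\{C(x)\mid x\in G\}$ is the set of element centralizers of $G$ (so $G$ itself is a member). Two elements $x,y\in G$ are $z$-equivalent (in the same $z$-class) if their centralizers are conjugate in $G$, i.e. $C(x)=gC(y)g^{-1}$ for some $g\in G$; this is an equivalence relation on $G$ whose classes are the $z$-classes, and $|z\text{-class}|$ denotes the number of $z$-classes of $G$. *)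

theory Defs
  imports "HOL-Algebra.Algebra"
begin

definition group_center :: "('a, 'b) monoid_scheme \<Rightarrow> 'a set" where
  "group_center G =
     {z \<in> carrier G. \<forall>g \<in> carrier G. z \<otimes>\<^bsub>G\<^esub> g = g \<otimes>\<^bsub>G\<^esub> z}"

definition centralizer :: "('a, 'b) monoid_scheme \<Rightarrow> 'a \<Rightarrow> 'a set" where
  "centralizer G x = {g \<in> carrier G. g \<otimes>\<^bsub>G\<^esub> x = x \<otimes>\<^bsub>G\<^esub> g}"

definition Cent :: "('a, 'b) monoid_scheme \<Rightarrow> 'a set set" where
  "Cent G = centralizer G ` carrier G"

definition z_equiv :: "('a, 'b) monoid_scheme \<Rightarrow> ('a \<times> 'a) set" where
  "z_equiv G =
     {(x, y). x \<in> carrier G \<and> y \<in> carrier G \<and>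
        (\<exists>g \<in> carrier G.
           centralizer G x = g <#\<^bsub>G\<^esub> centralizer G y #>\<^bsub>G\<^esub> inv\<^bsub>G\<^esub> g)}"

definition z_classes :: "('a, 'b) monoid_scheme \<Rightarrow> 'a set set" where
  "z_classes G = carrier G // z_equiv G"

text \<open>
  \<open>Mod\<close> and \<open>//\<close> are total, so we check that they are used as intended:
  the center is normal, and z-equivalence is an equivalence relation on the carrier.
\<close>

lemma group_center_normal:
  fixes G (structure)
  assumes "group G"
  shows "group_center G \<lhd> G"
proof -
  interpret group G by (fact assms)
  have "subgroup (group_center G) G"
  proof (rule subgroupI)
    show "group_center G \<subseteq> carrier G" "group_center G \<noteq> {}"
      by (auto simp: group_center_def)
  next
    fix a assume a: "a \<in> group_center G"
    have "inv a \<otimes> g = g \<otimes> inv a" if g: "g \<in> carrier G" for g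
    proof -
      have carr: "a \<in> carrier G" and comm: "g \<otimes> a = a \<otimes> g"
        using a g by (auto simp: group_center_def)
      have "inv a \<otimes> g = inv a \<otimes> (g \<otimes> a) \<otimes> inv a" using carr g by (simp add: m_assoc)
      also have "\<dots> = inv a \<otimes> a \<otimes> g \<otimes> inv a"
        unfolding comm using carr g by (simp add: m_assoc[symmetric])
      finally show ?thesis using carr g by simp
    qed
    moreover have "inv a \<in> carrier G" using a unfolding group_center_def by (blast intro: inv_closed)
    ultimately show "inv a \<in> group_center G" unfolding group_center_def by blast
  next
    fix a b assume ab: "a \<in> group_center G" "b \<in> group_center G"
    have "a \<otimes> b \<otimes> g = g \<otimes> (a \<otimes> b)" if g: "g \<in> carrier G" for g
    proof -
      have carr: "a \<in> carrier G" "b \<in> carrier G"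
        and comm: "a \<otimes> g = g \<otimes> a" "b \<otimes> g = g \<otimes> b"
        using ab g by (auto simp: group_center_def)
      have "a \<otimes> b \<otimes> g = a \<otimes> (g \<otimes> b)" using carr g comm(2) by (simp add: m_assoc)
      also have "\<dots> = g \<otimes> a \<otimes> b" using carr g comm(1) by (simp add: m_assoc[symmetric])
      finally show ?thesis using carr g by (simp add: m_assoc)
    qed
    moreover have "a \<otimes> b \<in> carrier G"
      using ab unfolding group_center_def by (blast intro: m_closed)
    ultimately show "a \<otimes> b \<in> group_center G" unfolding group_center_def by blast
  qed
  then show ?thesis
  proof (rule normalI)
    have "z \<otimes> x = x \<otimes> z" if "z \<in> group_center G" "x \<in> carrier G" for x z
      using that by (simp add: group_center_def)
    then show "\<forall>x\<in>carrier G. group_center G #> x = x <#\<^bsub>G\<^esub> group_center G"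
      unfolding r_coset_def l_coset_def by (intro ballI SUP_cong) simp_all
  qed
qed

lemma equiv_z_equiv:
  fixes G (structure)
  assumes "group G"
  shows "equiv (carrier G) (z_equiv G)"
proof -
  interpret group G by (fact assms)
  have sub: "centralizer G x \<subseteq> carrier G" for x by (auto simp: centralizer_def)
  have conj_conj: "g <#\<^bsub>G\<^esub> (h <#\<^bsub>G\<^esub> A #> inv h) #> inv g = (g \<otimes> h) <#\<^bsub>G\<^esub> A #> inv (g \<otimes> h)"
    if "g \<in> carrier G" "h \<in> carrier G" "A \<subseteq> carrier G" for g h A
    using that by (simp add: coset_assoc coset_mult_assoc lcos_m_assoc
        l_coset_subset_G r_coset_subset_G inv_mult_group)
  have conj_one: "\<one> <#\<^bsub>G\<^esub> A #> inv \<one> = A" if "A \<subseteq> carrier G" for A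
    using that by (simp add: lcos_mult_one)
  show ?thesis
  proof (rule equivI)
    show "z_equiv G \<subseteq> carrier G \<times> carrier G" by (auto simp: z_equiv_def)
    show "refl_on (carrier G) (z_equiv G)"
      by (rule refl_onI) (use conj_one[OF sub] in \<open>auto simp: z_equiv_def intro!: bexI[of _ \<one>]\<close>)
    show "sym (z_equiv G)"
    proof (rule symI)
      fix x y assume "(x, y) \<in> z_equiv G"
      then obtain g where g: "g \<in> carrier G" "x \<in> carrier G" "y \<in> carrier G"
        "centralizer G x = g <#\<^bsub>G\<^esub> centralizer G y #> inv g" by (auto simp: z_equiv_def)
      have "inv g <#\<^bsub>G\<^esub> centralizer G x #> inv (inv g) = centralizer G y"
        unfolding g(4) using g conj_conj[of "inv g" g, OF _ _ sub[of y]] conj_one[OF sub[of y]] by simp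
      then show "(y, x) \<in> z_equiv G" using g by (auto simp: z_equiv_def intro!: bexI[of _ "inv g"])
    qed
    show "trans (z_equiv G)"
    proof (rule transI)
      fix x y z assume "(x, y) \<in> z_equiv G" "(y, z) \<in> z_equiv G"
      then obtain g h where g: "g \<in> carrier G" "h \<in> carrier G" "x \<in> carrier G" "z \<in> carrier G"
        "centralizer G x = g <#\<^bsub>G\<^esub> centralizer G y #> inv g"
        "centralizer G y = h <#\<^bsub>G\<^esub> centralizer G z #> inv h" by (auto simp: z_equiv_def)
      have "centralizer G x = (g \<otimes> h) <#\<^bsub>G\<^esub> centralizer G z #> inv (g \<otimes> h)"
        using g(5) conj_conj[OF g(1,2) sub[of z]] by (simp add: g(6))
      then show "(x, z) \<in> z_equiv G" using g by (auto simp: z_equiv_def intro!: bexI[of _ "g \<otimes> h"])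
    qed
  qed
qed

end

theory Submission
  imports Defs
begin

text \<open>
  Write \<open>Z\<close> for the center and \<open>C(x)\<close> for the centralizer of \<open>x\<close>.
  The right cosets of \<open>Z\<close>, the centralizers and the z-classes are the values of three maps on
  the carrier, each of which determines the next: \<open>C(x)\<close> depends only on \<open>Z x\<close>, and the z-class
  of \<open>x\<close> depends only on \<open>C(x)\<close>. In a finite group the numbers of values therefore
  satisfy \<open>|z-classes| \<le> |Cent G| \<le> |G/Z|\<close>, and if the outer two agree so does the middle one.

  Conversely, if \<open>|Cent G| = |G/Z|\<close>, then \<open>C(x) = C(y)\<close> forces \<open>Z x = Z y\<close>. An element and its
  inverse have the same centralizer, so every element of \<open>G/Z\<close> is its own inverse, and such a
  group is abelian. Hence \<open>x y\<close> and \<open>y x\<close> always differ by a central factor. As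
  centralizers absorb central factors, each of them is invariant under conjugation. Conjugate
  centralizers are thus equal, so the z-classes correspond to the centralizers one to one.
\<close>

text \<open>
  If the value of \<open>f\<close> determines that of \<open>g\<close>, then \<open>g\<close> factors through \<open>f\<close>. The factor map
  sends \<open>f ` A\<close> onto \<open>g ` A\<close>; between finite sets of the same size it must be injective.
\<close>

lemma
  assumes fin: "finite A"
    and determines: "\<And>x y. x \<in> A \<Longrightarrow> y \<in> A \<Longrightarrow> f x = f y \<Longrightarrow> g x = g y"
  shows card_image_le_if_determined: "card (g ` A) \<le> card (f ` A)"
    and determined_if_card_image_eq:
      "\<lbrakk>card (g ` A) = card (f ` A); x \<in> A; y \<in> A; g x = g y\<rbrakk> \<Longrightarrow> f x = f y"
proof -
  define h where "h = g \<circ> inv_into A f"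
  have h: "h (f x) = g x" if "x \<in> A" for x
    unfolding h_def comp_def using that
    by (intro determines) (auto intro: inv_into_into f_inv_into_f)
  then have image: "g ` A = h ` f ` A"
    by (force simp: image_image)
  show "card (g ` A) \<le> card (f ` A)"
    unfolding image using fin by (intro card_image_le) simp
  assume "card (g ` A) = card (f ` A)" and xy: "x \<in> A" "y \<in> A" "g x = g y"
  then have "inj_on h (f ` A)"
    unfolding image using fin by (intro eq_card_imp_inj_on) simp_all
  then show "f x = f y"
    by (rule inj_onD) (use xy h in simp_all)
qed

context group
begin

lemma r_coset_center_eqD:
  assumes "x \<in> carrier G" "y \<in> carrier G"
    and "group_center G #> x = group_center G #> y"
  obtains z where "z \<in> group_center G" "x = z \<otimes> y"
proof -
  interpret normal "group_center G" G
    by (rule group_center_normal) (rule is_group)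
  have "x \<in> group_center G #> x"
    using assms(1) subgroup_axioms by (rule rcos_self)
  then show ?thesis
    using that unfolding assms(3) by (auto simp: r_coset_def)
qed

lemma centralizer_center_mult:
  assumes z: "z \<in> group_center G" and x: "x \<in> carrier G"
  shows "centralizer G (z \<otimes> x) = centralizer G x"
proof -
  have "g \<otimes> (z \<otimes> x) = (z \<otimes> x) \<otimes> g \<longleftrightarrow> g \<otimes> x = x \<otimes> g" if g: "g \<in> carrier G" for g
  proof -
    have carr: "z \<in> carrier G" and comm: "z \<otimes> g = g \<otimes> z"
      using z g by (auto simp: group_center_def)
    have "g \<otimes> (z \<otimes> x) = z \<otimes> (g \<otimes> x)"
      using carr comm x g by (simp flip: m_assoc)
    then show ?thesis
      using carr x g by (simp add: m_assoc)
  qed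
  then show ?thesis
    by (auto simp: centralizer_def)
qed

text \<open>
  Commuting is symmetric, so this follows from the same fact with \<open>h\<close> in the role of \<open>x\<close>.
\<close>

lemma center_mult_in_centralizer:
  assumes z: "z \<in> group_center G" and h: "h \<in> centralizer G x" and x: "x \<in> carrier G"
  shows "z \<otimes> h \<in> centralizer G x"
proof -
  have hc: "h \<in> carrier G" and "x \<in> centralizer G (z \<otimes> h)"
    using h x centralizer_center_mult[OF z, of h] by (auto simp: centralizer_def)
  moreover have "z \<in> carrier G"
    using z by (simp add: group_center_def)
  ultimately show ?thesis
    by (simp add: centralizer_def)
qed

lemma centralizer_inv:
  assumes x: "x \<in> carrier G"
  shows "centralizer G (inv x) = centralizer G x"
proof -
  have subset: "centralizer G y \<subseteq> centralizer G (inv y)" if y: "y \<in> carrier G" for y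
  proof
    fix g assume "g \<in> centralizer G y"
    then have g: "g \<in> carrier G" and comm: "g \<otimes> y = y \<otimes> g"
      by (auto simp: centralizer_def)
    have "inv y \<otimes> g = inv y \<otimes> (g \<otimes> y) \<otimes> inv y"
      using g y by (simp add: m_assoc)
    also have "\<dots> = g \<otimes> inv y"
      unfolding comm using g y by (simp flip: m_assoc)
    finally show "g \<in> centralizer G (inv y)"
      using g by (simp add: centralizer_def)
  qed
  show ?thesis
    using subset[OF x] subset[of "inv x"] x by auto
qed

text \<open>
  A group whose elements are their own inverses is abelian, because inversion reverses products;
  this is applied to the quotient by the center.
\<close>

lemma commute_mod_center_if_involutive:
  assumes involutive:
      "\<And>x. x \<in> carrier G \<Longrightarrow> group_center G #> inv x = group_center G #> x"
    and x: "x \<in> carrier G" and y: "y \<in> carrier G"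
  shows "\<exists>z \<in> group_center G. x \<otimes> y = z \<otimes> (y \<otimes> x)"
proof -
  interpret normal "group_center G" G
    by (rule group_center_normal) (rule is_group)
  let ?Z = "group_center G"
  have "?Z #> (x \<otimes> y) = ?Z #> (inv y \<otimes> inv x)"
    using x y involutive[of "x \<otimes> y"] by (simp add: inv_mult_group)
  also have "\<dots> = (?Z #> inv y) <#> (?Z #> inv x)"
    using x y by (simp add: rcos_sum)
  also have "\<dots> = ?Z #> (y \<otimes> x)"
    using x y by (simp add: involutive rcos_sum)
  finally have "?Z #> (x \<otimes> y) = ?Z #> (y \<otimes> x)" .
  then show ?thesis
    by (rule r_coset_center_eqD[rotated 2]) (use x y in auto)
qed

text \<open>
  When products commute up to central factors, conjugation moves an element only within its coset
  of the center, and a centralizer is a union of such cosets.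
\<close>

lemma conjugate_centralizer_if_commute_mod_center:
  assumes commute: "\<And>x y. x \<in> carrier G \<Longrightarrow> y \<in> carrier G \<Longrightarrow>
      \<exists>z \<in> group_center G. x \<otimes> y = z \<otimes> (y \<otimes> x)"
    and g: "g \<in> carrier G" and x: "x \<in> carrier G"
  shows "g <#\<^bsub>G\<^esub> centralizer G x #> inv g = centralizer G x"
proof -
  let ?C = "centralizer G x"
  have sub: "?C \<subseteq> carrier G"
    by (auto simp: centralizer_def)
  have "g <#\<^bsub>G\<^esub> ?C = ?C #> g"
  proof (intro equalityI subsetI)
    fix k assume "k \<in> g <#\<^bsub>G\<^esub> ?C"
    then obtain h where h: "h \<in> ?C" "k = g \<otimes> h"
      by (auto simp: l_coset_def)
    then obtain z where z: "z \<in> group_center G" "k = z \<otimes> (h \<otimes> g)"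
      using commute[of g h] g sub by auto
    have "k = (z \<otimes> h) \<otimes> g"
      using z h(1) g sub by (auto simp: m_assoc group_center_def)
    then show "k \<in> ?C #> g"
      using center_mult_in_centralizer[OF z(1) h(1) x] by (auto simp: r_coset_def)
  next
    fix k assume "k \<in> ?C #> g"
    then obtain h where h: "h \<in> ?C" "k = h \<otimes> g"
      by (auto simp: r_coset_def)
    then obtain z where z: "z \<in> group_center G" "k = z \<otimes> (g \<otimes> h)"
      using commute[of h g] g sub by auto
    have "z \<in> carrier G" "h \<in> carrier G" "z \<otimes> g = g \<otimes> z"
      using z(1) h(1) g sub by (auto simp: group_center_def)
    then have "k = g \<otimes> (z \<otimes> h)"
      using z(2) g by (simp flip: m_assoc)
    then show "k \<in> g <#\<^bsub>G\<^esub> ?C"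
      using center_mult_in_centralizer[OF z(1) h(1) x] by (auto simp: l_coset_def)
  qed
  then show ?thesis
    using g sub by (simp add: coset_mult_assoc)
qed

end

theorem proposition3p2:
  fixes G :: "('a, 'b) monoid_scheme"
  assumes "group G"
    and "finite (carrier G)"
    and "\<not> comm_group G"
  shows "card (Cent G) = order (G Mod group_center G) \<longleftrightarrow>
         card (z_classes G) = order (G Mod group_center G)"
proof -
  interpret group G by (fact assms(1))
  note fin = assms(2)
  note equiv = equiv_z_equiv[OF assms(1)]
  let ?A = "carrier G" and ?Z = "group_center G"
  let ?coset = "\<lambda>x. ?Z #>\<^bsub>G\<^esub> x" and ?cent = "centralizer G"
    and ?zclass = "\<lambda>x. z_equiv G `` {x}"
  have quotient: "order (G Mod ?Z) = card (?coset ` ?A)"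
    by (simp add: order_def FactGroup_def RCOSETS_def UNION_singleton_eq_range)
  have classes: "z_classes G = ?zclass ` ?A"
    by (auto simp: z_classes_def quotient_def)
  have coset_cent: "?cent x = ?cent y"
    if "x \<in> ?A" "y \<in> ?A" "?coset x = ?coset y" for x y
  proof -
    from that obtain z where "z \<in> ?Z" "x = z \<otimes>\<^bsub>G\<^esub> y"
      by (rule r_coset_center_eqD)
    then show ?thesis
      using that(2) by (simp add: centralizer_center_mult)
  qed
  have cent_zclass: "?zclass x = ?zclass y"
    if "x \<in> ?A" "y \<in> ?A" "?cent x = ?cent y" for x y
  proof -
    have "(x, x) \<in> z_equiv G"
      using equiv that(1) by (auto dest: equiv_class_self)
    then have "(x, y) \<in> z_equiv G"
      using that by (auto simp: z_equiv_def)
    then show ?thesis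
      by (rule equiv_class_eq[OF equiv])
  qed
  have zclass_le: "card (?zclass ` ?A) \<le> card (?cent ` ?A)"
    using fin cent_zclass by (rule card_image_le_if_determined)
  have cent_le: "card (?cent ` ?A) \<le> card (?coset ` ?A)"
    using fin coset_cent by (rule card_image_le_if_determined)
  have "card (?zclass ` ?A) = card (?cent ` ?A)" if eq: "card (?cent ` ?A) = card (?coset ` ?A)"
  proof -
    have cent_coset: "?coset x = ?coset y" if "x \<in> ?A" "y \<in> ?A" "?cent x = ?cent y" for x y
      using fin coset_cent eq that by (rule determined_if_card_image_eq)
    have involutive: "?coset (inv\<^bsub>G\<^esub> x) = ?coset x" if "x \<in> ?A" for x
      by (rule cent_coset) (use that in \<open>simp_all add: centralizer_inv\<close>)
    have commute: "\<exists>z\<in>?Z. x \<otimes>\<^bsub>G\<^esub> y = z \<otimes>\<^bsub>G\<^esub> (y \<otimes>\<^bsub>G\<^esub> x)" if "x \<in> ?A" "y \<in> ?A" for x y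
      using involutive that by (rule commute_mod_center_if_involutive)
    have zclass_cent: "?cent x = ?cent y" if "x \<in> ?A" "y \<in> ?A" "?zclass x = ?zclass y" for x y
    proof -
      have "(x, y) \<in> z_equiv G"
        using eq_equiv_class[OF that(3) equiv that(2)] .
      then obtain g where "g \<in> ?A" "?cent x = g <#\<^bsub>G\<^esub> ?cent y #>\<^bsub>G\<^esub> inv\<^bsub>G\<^esub> g"
        by (auto simp: z_equiv_def)
      then show ?thesis
        using conjugate_centralizer_if_commute_mod_center[OF commute] that(2) by simp
    qed
    have "card (?cent ` ?A) \<le> card (?zclass ` ?A)"
      using fin zclass_cent by (rule card_image_le_if_determined)
    with zclass_le show ?thesis
      by simp
  qed
  then show ?thesis
    unfolding quotient classes Cent_def using zclass_le cent_le by auto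
qed

end
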